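(* Let $n$ be an even positive integer and let $c\in\mathbb{F}_{2^{n/2}}^*$ satisfy $\mathrm{Tr}_{n/2}(c)=0$. Then the function $x\mapsto cx^{2^{n/2}+1}$ is planar on $\mathbb{F}_{2^n}$.
   Context: $\mathrm{Tr}_m(x)=x+x^2+\cdots+x^{2^{m-1}}$ is the absolute trace on $\mathbb{F}_{2^m}$. A function $f:\mathbb{F}_{2^n}\to\mathbb{F}_{2^n}$ is planar if for every $\epsilon\in\mathbb{F}_{2^n}^*$ the map $x\mapsto f(x+\epsilon)+f(x)+\epsilon x$ is a permutation of $\mathbb{F}_{2^n}$. *)

theory Defs
  imports "HOL-Algebra.Algebra"
begin

text \<open>
  The trace polynomial is evaluated in an ambient ring \<open>R\<close>. For \<open>x\<close> in a subfield of \<open>R\<close> with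
  \<open>2 ^ m\<close> elements it is the absolute trace of that subfield.
\<close>

definition abs_trace :: "('a, 'b) ring_scheme \<Rightarrow> nat \<Rightarrow> 'a \<Rightarrow> 'a" where
  "abs_trace R m x = (\<Oplus>\<^bsub>R\<^esub>i\<in>{..<m}. x [^]\<^bsub>R\<^esub> ((2::nat) ^ i))"

text \<open>
  Planarity in the characteristic 2 sense, whence \<open>\<oplus>\<close> instead of differences. Functions are only
  relevant on the carrier.
\<close>

definition planar :: "('a, 'b) ring_scheme \<Rightarrow> ('a \<Rightarrow> 'a) \<Rightarrow> bool" where
  "planar R f \<longleftrightarrow>
     f \<in> carrier R \<rightarrow> carrier R \<and>
     (\<forall>\<epsilon>\<in>carrier R - {\<zero>\<^bsub>R\<^esub>}.
        bij_betw (\<lambda>x. f (x \<oplus>\<^bsub>R\<^esub> \<epsilon>) \<oplus>\<^bsub>R\<^esub> f x \<oplus>\<^bsub>R\<^esub> \<epsilon> \<otimes>\<^bsub>R\<^esub> x) (carrier R) (carrier R))"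

end

theory Submission
  imports Defs
begin

text \<open>
  Write \<open>q = 2 ^ (n div 2)\<close>. Up to an additive constant, the difference map of \<open>c x ^ (q + 1)\<close> in
  direction \<open>\<epsilon>\<close> is the additive map \<open>x \<mapsto> c t + \<epsilon> x\<close> with \<open>t = x ^ q \<epsilon> + x \<epsilon> ^ q\<close>. If
  \<open>x \<noteq> 0\<close> lies in its kernel, then \<open>c t = \<epsilon> x \<noteq> 0\<close>; since \<open>t ^ q = t\<close> and \<open>c ^ q = c\<close>, also
  \<open>\<epsilon> ^ q x ^ q = \<epsilon> x\<close>. Hence \<open>v = \<epsilon> ^ q x / t\<close> satisfies \<open>v\<^sup>2 + v = c\<^sup>2\<close> and \<open>v ^ q = v + 1\<close>.
  But the first equation telescopes to \<open>v ^ q + v = Tr(c)\<^sup>2 = 0\<close>, a contradiction.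
\<close>

context cring
begin

lemma char2_double:
  assumes "\<one> \<oplus> \<one> = \<zero>" "x \<in> carrier R"
  shows "x \<oplus> x = \<zero>"
proof -
  have "x \<oplus> x = x \<otimes> (\<one> \<oplus> \<one>)"
    using assms(2) by (simp add: r_distr)
  then show ?thesis using assms by simp
qed

text \<open>Companion of \<open>char2_double\<close> for simplification: once \<open>a_ac\<close>
  has sorted a sum, equal summands are neighbours but may be followed by further terms, and this
  form cancels them there.\<close>

lemma char2_double_left:
  assumes "\<one> \<oplus> \<one> = \<zero>" "x \<in> carrier R" "y \<in> carrier R"
  shows "x \<oplus> (x \<oplus> y) = y"
  using assms char2_double[of x] by (simp add: a_assoc[symmetric])

lemma char2_add_eq_zero_iff:
  assumes "\<one> \<oplus> \<one> = \<zero>" "x \<in> carrier R" "y \<in> carrier R"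
  shows "x \<oplus> y = \<zero> \<longleftrightarrow> x = y"
  using assms char2_double char2_double_left[of x y] by auto

lemma char2_square_add:
  assumes "\<one> \<oplus> \<one> = \<zero>" "x \<in> carrier R" "y \<in> carrier R"
  shows "(x \<oplus> y) [^] (2::nat) = x [^] (2::nat) \<oplus> y [^] (2::nat)"
  using assms
  by (simp add: numeral_2_eq_2 l_distr r_distr a_ac m_ac char2_double char2_double_left)

lemma char2_frobenius_add:
  assumes "\<one> \<oplus> \<one> = \<zero>" "x \<in> carrier R" "y \<in> carrier R"
  shows "(x \<oplus> y) [^] ((2::nat) ^ k) = x [^] ((2::nat) ^ k) \<oplus> y [^] ((2::nat) ^ k)"
proof (induction k)
  case 0
  show ?case using assms by simp
next
  case (Suc k)
  have pow_Suc: "z [^] ((2::nat) ^ Suc k) = (z [^] ((2::nat) ^ k)) [^] (2::nat)"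
    if "z \<in> carrier R" for z
    using that by (simp add: nat_pow_pow mult.commute)
  show ?case
    using assms by (simp add: pow_Suc Suc char2_square_add del: power_Suc)
qed

lemma abs_trace_closed:
  "x \<in> carrier R \<Longrightarrow> abs_trace R m x \<in> carrier R"
  unfolding abs_trace_def by (rule finsum_closed) auto

lemma abs_trace_Suc:
  "x \<in> carrier R \<Longrightarrow> abs_trace R (Suc m) x = x [^] ((2::nat) ^ m) \<oplus> abs_trace R m x"
  unfolding abs_trace_def lessThan_Suc by (rule finsum_insert) auto

lemma char2_artin_schreier_telescope:
  assumes two: "\<one> \<oplus> \<one> = \<zero>" and v: "v \<in> carrier R" and c: "c \<in> carrier R"
    and eq: "v [^] (2::nat) \<oplus> v = c [^] (2::nat)"
  shows "v [^] ((2::nat) ^ m) \<oplus> v = abs_trace R m c [^] (2::nat)"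
proof (induction m)
  case 0
  show ?case using two v by (simp add: abs_trace_def char2_double numeral_2_eq_2)
next
  case (Suc m)
  let ?q = "(2::nat) ^ m"
  have "v [^] ((2::nat) ^ Suc m) \<oplus> v = (v [^] (2::nat)) [^] ?q \<oplus> v"
    using v by (simp add: nat_pow_pow)
  \<comment> \<open>Inserting \<open>v [^] ?q\<close> twice changes nothing in characteristic 2. The
    first bracket becomes the \<open>?q\<close>-th power of the hypothesis \<open>eq\<close>, the
    second is the induction hypothesis.\<close>
  also have "\<dots> = ((v [^] (2::nat)) [^] ?q \<oplus> v [^] ?q) \<oplus> (v [^] ?q \<oplus> v)"
    using two v by (simp add: a_assoc char2_double_left)
  also have "\<dots> = (v [^] (2::nat) \<oplus> v) [^] ?q \<oplus> abs_trace R m c [^] (2::nat)"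
    using two v by (simp add: char2_frobenius_add Suc)
  also have "\<dots> = (c [^] ?q) [^] (2::nat) \<oplus> abs_trace R m c [^] (2::nat)"
    using c by (simp add: eq nat_pow_pow mult.commute)
  also have "\<dots> = abs_trace R (Suc m) c [^] (2::nat)"
    using two c by (simp add: abs_trace_Suc abs_trace_closed char2_square_add)
  finally show ?case .
qed

end

text \<open>Lagrange's theorem in the unit group, with zero treated apart. Applied to the big field
  it makes the q-th power map an involution; applied to the subfield it shows that this map fixes
  \<open>c\<close>.\<close>

lemma (in field) pow_order_eq:
  assumes "finite (carrier R)" "x \<in> carrier R"
  shows "x [^] order R = x"
proof (cases "x = \<zero>")
  case True
  then show ?thesis
    using assms(1) order_gt_0_iff_finite by (simp add: nat_pow_zero)
next
  case False
  then have u: "x \<in> Units R" using assms(2) by (simp add: field_Units)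
  interpret U: group "units_of R" by (rule units_group)
  have "order (units_of R) = order R - 1"
    using assms(1) by (simp add: order_def units_of_carrier field_Units)
  with u have "x [^]\<^bsub>units_of R\<^esub> (order R - 1) = \<one>"
    using U.pow_order_eq_1[of x] by (simp add: units_of_carrier units_of_one)
  with u have "x [^] (order R - 1) = \<one>" by (simp add: units_of_pow)
  then have "x [^] Suc (order R - 1) = x" using assms(2) by simp
  moreover have "order R > 0" using assms(1) order_gt_0_iff_finite by simp
  ultimately show ?thesis by simp
qed

text \<open>Since -1 squares to 1, its power with the even exponent \<open>order R\<close> is 1; by
  \<open>pow_order_eq\<close> that power is also -1.\<close>

lemma (in field) even_order_imp_char2:
  assumes "finite (carrier R)" "even (order R)"
  shows "\<one> \<oplus> \<one> = \<zero>"
proof -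
  obtain k where k: "order R = 2 * k" using assms(2) by blast
  have "(\<ominus> \<one>) [^] (2::nat) = \<one>" by (simp add: numeral_2_eq_2 l_minus)
  then have "((\<ominus> \<one>) [^] (2::nat)) [^] k = \<one>" by simp
  then have "(\<ominus> \<one>) [^] order R = \<one>" by (simp add: k nat_pow_pow)
  with pow_order_eq[OF assms(1), of "\<ominus> \<one>"] have "\<ominus> \<one> = \<one>" by simp
  then show ?thesis using r_neg[of \<one>] by simp
qed

lemma (in field) planar_difference_kernel_trivial:
  fixes m :: nat
  defines "q \<equiv> (2::nat) ^ m"
  assumes two: "\<one> \<oplus> \<one> = \<zero>"
    and frob: "\<And>x. x \<in> carrier R \<Longrightarrow> (x [^] q) [^] q = x"
    and c: "c \<in> carrier R" "c [^] q = c" "abs_trace R m c = \<zero>"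
    and e: "e \<in> carrier R" "e \<noteq> \<zero>" and x: "x \<in> carrier R"
    and ker: "c \<otimes> (x [^] q \<otimes> e \<oplus> x \<otimes> e [^] q) = e \<otimes> x"
  shows "x = \<zero>"
proof (rule ccontr)
  assume "x \<noteq> \<zero>"
  define t where "t = x [^] q \<otimes> e \<oplus> x \<otimes> e [^] q"
  have tc: "t \<in> carrier R" unfolding t_def using x e by simp
  have ct: "c \<otimes> t = e \<otimes> x" using ker by (simp add: t_def)
  have "e \<otimes> x \<noteq> \<zero>" using e x \<open>x \<noteq> \<zero>\<close> integral by blast
  then have "t \<noteq> \<zero>" using ct c(1) by auto
  then have tU: "t \<in> Units R" using tc by (simp add: field_Units)
  define s where "s = inv t"
  have s: "s \<in> carrier R" "t \<otimes> s = \<one>" using tU by (auto simp: s_def)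
  have tq: "t [^] q = t"
    \<comment> \<open>By \<open>frob\<close>, the q-th power swaps the two summands of
      \<open>t\<close>.\<close>
    unfolding t_def using x e two
    by (simp add: q_def char2_frobenius_add nat_pow_distrib frob[unfolded q_def] a_ac m_ac)
  have ex: "e [^] q \<otimes> x [^] q = e \<otimes> x"
  proof -
    have "e [^] q \<otimes> x [^] q = (c \<otimes> t) [^] q"
      using e x by (simp add: ct nat_pow_distrib)
    also have "\<dots> = e \<otimes> x" using c tc by (simp add: nat_pow_distrib tq flip: ct)
    finally show ?thesis .
  qed
  have "s [^] q = s"
  proof -
    have "t \<otimes> s [^] q = (t \<otimes> s) [^] q" using tc s(1) by (simp add: nat_pow_distrib tq)
    then have "t \<otimes> s [^] q = t \<otimes> s" using s by simp
    then show ?thesis using \<open>t \<noteq> \<zero>\<close> tc s(1) m_lcancel by simp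
  qed
  \<comment> \<open>\<open>v\<close> is one summand of \<open>t\<close> divided by \<open>t\<close>,
    and its q-th power is the other one divided by \<open>t\<close>. So they add up to 1, and their
    product is \<open>(e x / t)\<close> squared, that is \<open>c\<close> squared: both are roots of
    \<open>Z^2 + Z + c^2\<close>.\<close>
  define v where "v = e [^] q \<otimes> x \<otimes> s"
  have vc: "v \<in> carrier R" unfolding v_def using e x s by simp
  have vq: "v [^] q = e \<otimes> x [^] q \<otimes> s"
    unfolding v_def using e x s by (simp add: nat_pow_distrib frob \<open>s [^] q = s\<close>)
  have sum: "v [^] q \<oplus> v = \<one>"
  proof -
    have "v [^] q \<oplus> v = t \<otimes> s"
      unfolding vq unfolding v_def t_def using e x s(1) by (simp add: l_distr r_distr m_ac)
    then show ?thesis using s by simp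
  qed
  have prod: "v [^] q \<otimes> v = c [^] (2::nat)"
  proof -
    have "v [^] q \<otimes> v = (e [^] q \<otimes> x [^] q) \<otimes> (e \<otimes> x) \<otimes> (s \<otimes> s)"
      unfolding vq unfolding v_def using e x s(1) by (simp add: m_ac)
    also have "\<dots> = (c \<otimes> t) \<otimes> (c \<otimes> t) \<otimes> (s \<otimes> s)" by (simp add: ex ct)
    also have "\<dots> = c \<otimes> c \<otimes> ((t \<otimes> s) \<otimes> (t \<otimes> s))" using c tc s(1) by (simp add: m_ac)
    also have "\<dots> = c [^] (2::nat)" using c s by (simp add: numeral_2_eq_2)
    finally show ?thesis .
  qed
  \<comment> \<open>The linear term \<open>v\<close> is multiplied by 1, written as
    \<open>v [^] q \<oplus> v\<close>; then the two copies of \<open>v \<otimes> v\<close>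
    cancel.\<close>
  have "v [^] (2::nat) \<oplus> v = v \<otimes> v \<oplus> (v [^] q \<oplus> v) \<otimes> v"
    using vc by (simp add: sum numeral_2_eq_2)
  also have "\<dots> = v [^] q \<otimes> v"
    using vc two by (simp add: l_distr a_ac char2_double_left)
  finally have "v [^] (2::nat) \<oplus> v = c [^] (2::nat)" by (simp add: prod)
  from char2_artin_schreier_telescope[OF two vc c(1) this, of m]
  have "v [^] q \<oplus> v = \<zero>" by (simp add: c(3) q_def numeral_2_eq_2)
  with sum show False by simp
qed

theorem theorem3p1:
  fixes F :: "('a, 'b) ring_scheme" and K :: "'a set" and n :: nat and c :: 'a
  assumes "n > 0" and "even n"
    and "field F" and "order F = 2 ^ n"
    and "subfield K F" and "card K = 2 ^ (n div 2)"
    and "c \<in> K - {\<zero>\<^bsub>F\<^esub>}"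
    and "abs_trace F (n div 2) c = \<zero>\<^bsub>F\<^esub>"
  shows "planar F (\<lambda>x. c \<otimes>\<^bsub>F\<^esub> x [^]\<^bsub>F\<^esub> ((2::nat) ^ (n div 2) + 1))"
proof -
  interpret field F by fact
  define q where "q = (2::nat) ^ (n div 2)"
  have fin: "finite (carrier F)"
    using assms(4) order_gt_0_iff_finite by simp
  have two: "\<one>\<^bsub>F\<^esub> \<oplus>\<^bsub>F\<^esub> \<one>\<^bsub>F\<^esub> = \<zero>\<^bsub>F\<^esub>"
    using even_order_imp_char2[OF fin] assms(1,4) by simp
  \<comment> \<open>Evenness of \<open>n\<close> enters here: halving it loses nothing, so q squared
    is exactly the field order.\<close>
  have qq: "q * q = order F"
    using assms(2,4) by (auto simp: q_def power_add[symmetric])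
  have frob: "(x [^]\<^bsub>F\<^esub> q) [^]\<^bsub>F\<^esub> q = x" if "x \<in> carrier F" for x
    using that pow_order_eq[OF fin that] by (simp add: nat_pow_pow qq)
  have KF: "K \<subseteq> carrier F" using assms(5) by (rule subfieldE(3))
  then have c: "c \<in> carrier F" using assms(7) by auto
  interpret K: field "F\<lparr>carrier := K\<rparr>" using assms(5) by (rule subfield_iff(2))
  \<comment> \<open>\<open>K\<close> is itself a field with q elements;
    \<open>nat_pow_consistent\<close> identifies powers taken in \<open>K\<close> with powers in
    \<open>F\<close>.\<close>
  have cq: "c [^]\<^bsub>F\<^esub> q = c"
    using K.pow_order_eq[of c] assms(6,7) finite_subset[OF KF fin] nat_pow_consistent[of c q K]
    by (simp add: order_def q_def)
  have add_q: "(x \<oplus>\<^bsub>F\<^esub> y) [^]\<^bsub>F\<^esub> q = x [^]\<^bsub>F\<^esub> q \<oplus>\<^bsub>F\<^esub> y [^]\<^bsub>F\<^esub> q"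
    if "x \<in> carrier F" "y \<in> carrier F" for x y
    unfolding q_def using two that by (rule char2_frobenius_add)
  let ?f = "\<lambda>x. c \<otimes>\<^bsub>F\<^esub> x [^]\<^bsub>F\<^esub> (q + 1)"
  have "bij_betw (\<lambda>x. ?f (x \<oplus>\<^bsub>F\<^esub> e) \<oplus>\<^bsub>F\<^esub> ?f x \<oplus>\<^bsub>F\<^esub> e \<otimes>\<^bsub>F\<^esub> x) (carrier F) (carrier F)"
    if e: "e \<in> carrier F" "e \<noteq> \<zero>\<^bsub>F\<^esub>" for e
  proof -
    let ?g = "\<lambda>x. ?f (x \<oplus>\<^bsub>F\<^esub> e) \<oplus>\<^bsub>F\<^esub> ?f x \<oplus>\<^bsub>F\<^esub> e \<otimes>\<^bsub>F\<^esub> x"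
    let ?L = "\<lambda>x. c \<otimes>\<^bsub>F\<^esub> (x [^]\<^bsub>F\<^esub> q \<otimes>\<^bsub>F\<^esub> e \<oplus>\<^bsub>F\<^esub> x \<otimes>\<^bsub>F\<^esub> e [^]\<^bsub>F\<^esub> q)"
    \<comment> \<open>Expanding \<open>(x^q + e^q)(x + e)\<close>, the term in
      \<open>x^(q+1)\<close> cancels against \<open>?f x\<close>; the cross terms form
      \<open>?L x\<close> and the rest is the constant \<open>?f e\<close>.\<close>
    have g: "?g x = ?L x \<oplus>\<^bsub>F\<^esub> e \<otimes>\<^bsub>F\<^esub> x \<oplus>\<^bsub>F\<^esub> ?f e" if x: "x \<in> carrier F" for x
      using x e c two
      by (simp add: add_q l_distr r_distr a_ac m_ac char2_double char2_double_left)
    have "inj_on ?g (carrier F)"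
    proof (rule inj_onI)
      fix x y assume x: "x \<in> carrier F" and y: "y \<in> carrier F" and eq: "?g x = ?g y"
      have "?L x \<oplus>\<^bsub>F\<^esub> e \<otimes>\<^bsub>F\<^esub> x = ?L y \<oplus>\<^bsub>F\<^esub> e \<otimes>\<^bsub>F\<^esub> y"
        using eq x y e c unfolding g[OF x] g[OF y] by simp
      \<comment> \<open>Subtraction is addition here, so by additivity \<open>x + y\<close> lies in
        the kernel.\<close>
      then have "(?L x \<oplus>\<^bsub>F\<^esub> e \<otimes>\<^bsub>F\<^esub> x) \<oplus>\<^bsub>F\<^esub> (?L y \<oplus>\<^bsub>F\<^esub> e \<otimes>\<^bsub>F\<^esub> y) = \<zero>\<^bsub>F\<^esub>"
        using x y e c two by (subst char2_add_eq_zero_iff) simp_all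
      moreover have "(?L x \<oplus>\<^bsub>F\<^esub> e \<otimes>\<^bsub>F\<^esub> x) \<oplus>\<^bsub>F\<^esub> (?L y \<oplus>\<^bsub>F\<^esub> e \<otimes>\<^bsub>F\<^esub> y)
          = ?L (x \<oplus>\<^bsub>F\<^esub> y) \<oplus>\<^bsub>F\<^esub> e \<otimes>\<^bsub>F\<^esub> (x \<oplus>\<^bsub>F\<^esub> y)"
        using x y e c by (simp add: add_q l_distr r_distr a_ac m_ac)
      ultimately have "?L (x \<oplus>\<^bsub>F\<^esub> y) = e \<otimes>\<^bsub>F\<^esub> (x \<oplus>\<^bsub>F\<^esub> y)"
        using x y e c two char2_add_eq_zero_iff by simp
      then have "x \<oplus>\<^bsub>F\<^esub> y = \<zero>\<^bsub>F\<^esub>"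
        using planar_difference_kernel_trivial[of "n div 2" c e "x \<oplus>\<^bsub>F\<^esub> y"] two frob c cq assms(8) e x y
        by (simp add: q_def)
      then show "x = y" using x y two char2_add_eq_zero_iff by simp
    qed
    \<comment> \<open>On a finite carrier an injective self-map is bijective.\<close>
    moreover have "?g ` carrier F \<subseteq> carrier F" using e c by auto
    ultimately show ?thesis
      using endo_inj_surj[OF fin] unfolding bij_betw_def by blast
  qed
  moreover have "?f \<in> carrier F \<rightarrow> carrier F" using c by simp
  ultimately show ?thesis by (simp add: planar_def q_def)
qed

end
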